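(* For every $a\in\mathbb{C}$ with $\tfrac43-a\notin\{0,-1,-2,\dots\}$, $$F\!\left(1-2a,\tfrac43-2a;\tfrac43-a;-\tfrac18\right)=\frac{3^{3a-2}\sqrt{\pi}\;\Gamma(\tfrac43-a)}{2^{4a-8/3}\,\Gamma(\tfrac23)\,\Gamma(\tfrac76-a)}.$$
   Context: $F(a,b;c;x)=\sum_{n\ge0}\frac{(a,n)(b,n)}{(c,n)(1,n)}x^n$ with $(\alpha,n)=\Gamma(\alpha+n)/\Gamma(\alpha)$ is the Gauss hypergeometric series. $1/\Gamma$ is interpreted as $0$ at the poles of $\Gamma$. *)

theory Defs
  imports "HOL-Analysis.Analysis"
begin

text \<open>
  The Gauss series. The shifted factorial \<open>(\<alpha>,n) = \<Gamma>(\<alpha>+n)/\<Gamma>(\<alpha>)\<close> is \<^const>\<open>pochhammer\<close>, which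
  agrees with the Gamma quotient when \<open>\<alpha>\<close> is not a pole (fact \<open>pochhammer_Gamma\<close>) and is its
  continuous extension at the poles, so that a non-positive integer \<open>a\<close> or \<open>b\<close> gives a terminating
  series. The series converges for \<open>|x| < 1\<close>, see \<open>summable_hypergeo_F\<close> below;
  it is meaningful only if \<open>c\<close> is not a non-positive integer.
\<close>
definition hypergeo_F :: "complex \<Rightarrow> complex \<Rightarrow> complex \<Rightarrow> complex \<Rightarrow> complex" where
  "hypergeo_F a b c x =
     (\<Sum>n. (pochhammer a n * pochhammer b n) / (pochhammer c n * pochhammer 1 n) * x ^ n)"

lemma summable_hypergeo_F:
  fixes a b c x :: complex
  assumes x: "norm x < 1"
  shows "summable (\<lambda>n. (pochhammer a n * pochhammer b n) / (pochhammer c n * pochhammer 1 n) * x ^ n)"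
    (is "summable ?f")
proof -
  define r where "r = (\<lambda>n. ((a + of_nat n) / of_nat n) * ((b + of_nat n) / of_nat n) /
    (((c + of_nat n) / of_nat n) * ((1 + of_nat n) / of_nat n)) * x)"
  have lim: "(\<lambda>n. (z + of_nat n) / of_nat n) \<longlonglongrightarrow> 1" for z :: complex
  proof -
    have "(\<lambda>n. z / of_nat n + 1) \<longlonglongrightarrow> 0 + 1"
      by (intro tendsto_intros lim_const_over_n)
    then have "(\<lambda>n. z / of_nat n + 1) \<longlonglongrightarrow> 1" by simp
    moreover have "\<forall>\<^sub>F n in sequentially. z / of_nat n + 1 = (z + of_nat n) / of_nat n"
      using eventually_gt_at_top[of 0] by eventually_elim (simp add: field_simps)
    ultimately show ?thesis by (rule Lim_transform_eventually)
  qed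
  have "r \<longlonglongrightarrow> 1 * 1 / (1 * 1) * x"
    unfolding r_def by (intro tendsto_intros lim) auto
  then have "(\<lambda>n. norm (r n)) \<longlonglongrightarrow> norm x"
    using tendsto_norm by fastforce
  moreover obtain q where q: "norm x < q" "q < 1"
    using x dense by blast
  ultimately have "\<forall>\<^sub>F n in sequentially. norm (r n) < q"
    by (simp add: order_tendstoD)
  then have "\<forall>\<^sub>F n in sequentially. norm (r n) < q \<and> n > 0"
    using eventually_gt_at_top[of 0] by eventually_elim simp
  then obtain N where N: "\<And>n. n \<ge> N \<Longrightarrow> norm (r n) < q \<and> n > 0"
    unfolding eventually_sequentially by blast
  show ?thesis
  proof (rule summable_ratio_test)
    show "q < 1" by (fact q)
    fix n assume n: "N \<le> n"
    then have "n > 0" using N by blast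
    have "?f (Suc n) = r n * ?f n"
      using \<open>n > 0\<close> by (simp add: r_def pochhammer_Suc mult_ac)
    then have "norm (?f (Suc n)) = norm (r n) * norm (?f n)"
      by (simp only: norm_mult)
    also have "\<dots> \<le> q * norm (?f n)"
      using N[OF n] by (intro mult_right_mono) auto
    finally show "norm (?f (Suc n)) \<le> q * norm (?f n)" .
  qed
qed

end

theory Submission
  imports Defs "HOL-Complex_Analysis.Complex_Analysis"
begin

text \<open>
  Both sides satisfy the same first order recurrence in \<open>a\<close>, and a growth estimate shows that this
  recurrence, together with one common value, determines them.

  Under \<open>a \<mapsto> a + 1\<close> the parameters move by \<open>(-2, -2, -1)\<close>. Three such contiguous series are
  linearly dependent in general; at \<open>x = -1/8\<close> two of them already are, and
  \<open>(1/3 - a) F(a + 1) = 27/16 (1/6 - a) F(a)\<close> (\<open>hyp_value_rec\<close>). This is a telescoping identity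
  between the terms of the two series, in the style of Zeilberger; \<open>cert_poly\<close> is its certificate.
  The Gamma quotient obeys the same recurrence (\<open>gamma_value_rec\<close>) by the functional equation of
  Gamma.

  Hence the quotient \<open>h\<close> of the two sides has period 1. It is holomorphic in the half plane
  \<open>Re a < 11/12\<close> and therefore extends to an entire function of period 1
  (\<open>periodic_half_plane_extension\<close>). At \<open>a = 1/2\<close> the series is reduced to its first term, and
  the duplication and reflection formulas show that the other side equals 1 there as well. So
  \<open>h = 1\<close> on \<open>1/2 + \<int>\<close>. An entire function bounded by \<open>C exp (c \<bar>Im z\<bar>)\<close>
  with \<open>c < \<pi>\<close> cannot vanish on a translate of \<open>\<int>\<close> unless it is zero
  (\<open>entire_vanishing_on_Ints_eq_0\<close>), and \<open>h - 1\<close> has such a bound for a crude reason: the terms of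
  the series are dominated by those of \<open>(1 - 1/4) powr (- \<bar>4/3 - 2a\<bar>)\<close> (\<open>norm_hyp_term_le\<close>), which is
  of type \<open>2 ln (4/3) < 2/3\<close>, while the Gamma quotient is bounded away from 0 in a strip
  (\<open>norm_gamma_value_ge\<close>). Therefore \<open>h = 1\<close>, and the recurrence carries the equality from the
  half plane to all admissible \<open>a\<close>.
\<close>

section \<open>The contiguity relation\<close>

definition hyp_term :: "complex \<Rightarrow> nat \<Rightarrow> complex" where
  "hyp_term a n = (pochhammer (1 - 2 * a) n * pochhammer (4/3 - 2 * a) n) /
     (pochhammer (4/3 - a) n * pochhammer 1 n) * (- 1/8) ^ n"

definition hyp_value :: "complex \<Rightarrow> complex" where
  "hyp_value a = hypergeo_F (1 - 2 * a) (4/3 - 2 * a) (4/3 - a) (- 1/8)"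

lemma hyp_term_sums: "hyp_term a sums hyp_value a"
  unfolding hyp_term_def hyp_value_def hypergeo_F_def using summable_hypergeo_F[of "-1/8"]
  by (intro summable_sums) (simp add: norm_divide)

lemma hyp_term_0 [simp]: "hyp_term a 0 = 1"
  by (simp add: hyp_term_def)

lemma hyp_term_Suc: "hyp_term a (Suc n) = hyp_term a n * ((1 - 2 * a + of_nat n) * (4/3 - 2 * a + of_nat n) /
     ((4/3 - a + of_nat n) * (1 + of_nat n)) * (- 1/8))"
  by (simp add: hyp_term_def pochhammer_Suc mult_ac)

lemma hyp_term_shift:
  assumes "1/3 - a \<noteq> 0"
  shows "(1/3 - a) * hyp_term (a + 1) (n + 2) =
    (- 1 - 2 * a) * (- 2 * a) * (- 2/3 - 2 * a) * (1/3 - 2 * a) /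
    ((4/3 - a + of_nat n) * (1 + of_nat n) * (2 + of_nat n)) * (- 1/8)\<^sup>2 * hyp_term a n"
proof -
  have 1: "pochhammer (1 - 2 * (a + 1)) (n + 2) = (- 1 - 2 * a) * (- 2 * a) * pochhammer (1 - 2 * a) n"
    by (simp add: pochhammer_rec algebra_simps)
  have 2: "pochhammer (4/3 - 2 * (a + 1)) (n + 2) =
      (- 2/3 - 2 * a) * (1/3 - 2 * a) * pochhammer (4/3 - 2 * a) n"
  proof -
    have "pochhammer (4/3 - 2 * (a + 1)) (n + 2) = (4/3 - 2 * (a + 1)) * ((4/3 - 2 * (a + 1) + 1) *
       pochhammer (4/3 - 2 * (a + 1) + 1 + 1) n)"
      by (simp add: pochhammer_rec del: add_divide_distrib)
    moreover have "4/3 - 2 * (a + 1) + 1 + 1 = 4/3 - 2 * a" "4/3 - 2 * (a + 1) + 1 = 1/3 - 2 * a"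
       "4/3 - 2 * (a + 1) = - 2/3 - 2 * a" by (simp_all add: field_simps)
    ultimately show ?thesis by (simp only: mult.assoc)
  qed
  have 3: "pochhammer (4/3 - (a + 1)) (n + 2) =
      (1/3 - a) * (pochhammer (4/3 - a) n * (4/3 - a + of_nat n))"
  proof -
    have "4/3 - (a + 1) = 1/3 - a" "1/3 - a + 1 = 4/3 - a" by (simp_all add: field_simps)
    moreover have "pochhammer (1/3 - a) (n + 2) = (1/3 - a) * pochhammer (1/3 - a + 1) (Suc n)"
      by (simp add: pochhammer_rec)
    ultimately show ?thesis by (simp only: pochhammer_Suc)
  qed
  have 4: "pochhammer (1::complex) (n + 2) = pochhammer 1 n * (1 + of_nat n) * (2 + of_nat n)"
    by (simp add: pochhammer_Suc)
  show ?thesis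
    unfolding hyp_term_def 1 2 3 4 power_add using assms by (simp add: mult_ac power2_eq_square)
qed

text \<open>
  The polynomial is the solution \<open>p\<close>, quadratic in \<open>n\<close>, of the equation to which the ansatz
  \<open>(1/3 - a) t\<^sub>n(a+1) - 27/16 (1/6 - a) t\<^sub>n(a) = G\<^sub>n\<^sub>+\<^sub>1 - G\<^sub>n\<close> reduces when \<open>G\<^sub>n\<close> is taken to be
  \<open>p(n)\<close> times a hypergeometric term. Comparing leading coefficients gives \<open>1/4 - 3/2 a\<close>, and the
  values at \<open>n = 1 + 2a\<close> and \<open>n = 2/3 + 2a\<close>, where the coefficient of \<open>p(n + 1)\<close> vanishes, give the
  linear part.
\<close>
definition cert_poly :: "complex \<Rightarrow> complex \<Rightarrow> complex" where
  "cert_poly a n = (1/4 - 3/2 * a) * (n - 1 - 2 * a) * (n - 2/3 - 2 * a) +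
     2 * a * (2 * a - 1/3) * (n - 4 * a - 5/3)"

text \<open>
  The partial sums stop at \<open>N + 2\<close> because \<open>1 - 2(a + 1) = (1 - 2a) - 2\<close>: written with the
  Pochhammer symbols of \<open>1 - 2a\<close>, the general \<open>G\<^sub>n\<close> contains \<open>(1 - 2a, n - 2)\<close>, which for \<open>n < 2\<close>
  has poles. Starting at \<open>n = 2\<close> avoids any exceptional \<open>a\<close>.
\<close>
lemma telescoped_sum:
  assumes "1/3 - a \<notin> \<int>\<^sub>\<le>\<^sub>0"
  shows "(1/3 - a) * (\<Sum>n<N + 2. hyp_term (a + 1) n) - 27/16 * (1/6 - a) * (\<Sum>n<N + 2. hyp_term a n) =
    cert_poly a (of_nat N + 2) / ((4/3 - a + of_nat N) * (1 + of_nat N)) * (- 1/8)\<^sup>2 * hyp_term a N"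
proof -
  have nz: "1/3 - a + of_nat n \<noteq> 0" for n
    using assms plus_of_nat_eq_0_imp by blast
  have c0: "1/3 - a \<noteq> 0" using nz[of 0] by simp
  have nz1: "4/3 - a + of_nat n \<noteq> 0" for n
    using nz[of "Suc n"] by (simp add: algebra_simps)
  have nz2: "1 + of_nat n \<noteq> (0::complex)" "2 + of_nat n \<noteq> (0::complex)" for n
    using of_nat_neq_0[of n, where ?'a = complex] of_nat_neq_0[of "Suc n", where ?'a = complex]
    by (simp_all add: algebra_simps)
  show ?thesis
  proof (induction N)
    case 0
    have sum2: "(\<Sum>n<0 + 2. hyp_term b n) = 1 + hyp_term b 1" for b
      by (simp add: numeral_2_eq_2)
    have 1: "hyp_term a 1 = (1 - 2 * a) * (4/3 - 2 * a) / (4/3 - a) * (- 1/8)"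
      using hyp_term_Suc[of a 0] by simp
    have 2: "(1/3 - a) * hyp_term (a + 1) 1 = (- 1 - 2 * a) * (- 2/3 - 2 * a) * (- 1/8)"
      using hyp_term_Suc[of "a + 1" 0] c0 by (simp add: divide_simps) (simp add: algebra_simps)
    have nz3: "4/3 - a \<noteq> 0" using nz1[of 0] by simp
    have "(1/3 - a) * (1 + hyp_term (a + 1) 1) - 27/16 * (1/6 - a) * (1 + hyp_term a 1) =
        (1/3 - a) + (- 1 - 2 * a) * (- 2/3 - 2 * a) * (- 1/8)
          - 27/16 * (1/6 - a) * (1 + (1 - 2 * a) * (4/3 - 2 * a) / (4/3 - a) * (- 1/8))"
      unfolding distrib_left[of "1/3 - a"] 2 1 by simp
    also have "\<dots> = cert_poly a 2 / (4/3 - a) * (- 1/8)\<^sup>2"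
    proof -
      have *: "X - Y * (1 + Z / c * w) = P / c * v" if "c \<noteq> 0" "X * c - Y * (c + Z * w) = P * v"
        for X Y Z P c v w :: complex
        using that by (simp add: field_simps)
      show ?thesis
        by (rule *[OF nz3]) (simp add: cert_poly_def field_simps power2_eq_square)
    qed
    finally show ?case unfolding sum2 by simp
  next
    case (Suc N)
    define m where "m = (of_nat N :: complex)"
    define t where "t = hyp_term a N"
    have 1: "hyp_term a (Suc N) = t * ((1 - 2 * a + m) * (4/3 - 2 * a + m) / ((4/3 - a + m) * (1 + m)) * (- 1/8))"
      by (simp add: hyp_term_Suc t_def m_def)
    have 2: "hyp_term a (N + 2) = hyp_term a (Suc N) * ((2 - 2 * a + m) * (7/3 - 2 * a + m) /
        ((7/3 - a + m) * (2 + m)) * (- 1/8))"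
      using hyp_term_Suc[of a "Suc N"] by (simp add: m_def algebra_simps)
    have 3: "(1/3 - a) * hyp_term (a + 1) (N + 2) =
      (- 1 - 2 * a) * (- 2 * a) * (- 2/3 - 2 * a) * (1/3 - 2 * a) /
      ((4/3 - a + m) * (1 + m) * (2 + m)) * (- 1/8)\<^sup>2 * t"
      unfolding hyp_term_shift[OF c0] m_def t_def ..
    have n: "4/3 - a + m \<noteq> 0" "7/3 - a + m \<noteq> 0" "1 + m \<noteq> 0" "2 + m \<noteq> 0"
      using nz1[of N] nz1[of "Suc N"] nz2[of N] by (simp_all add: m_def algebra_simps)
    \<comment> \<open>The equation that defines the certificate, at \<open>n = N + 2\<close>.\<close>
    have key: "cert_poly a (m + 2) * (7/3 - a + m) * (2 + m) +
        (- 1 - 2 * a) * (- 2 * a) * (- 2/3 - 2 * a) * (1/3 - 2 * a) * (7/3 - a + m) -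
        27/16 * (1/6 - a) * ((1 - 2 * a + m) * (4/3 - 2 * a + m) * (2 - 2 * a + m) * (7/3 - 2 * a + m)) =
        cert_poly a (m + 3) * (1 - 2 * a + m) * (4/3 - 2 * a + m) * (- 1/8)"
      unfolding cert_poly_def by (simp add: field_simps)
    \<comment> \<open>Clearing denominators with the parameters abstracted, which keeps the polynomials unexpanded.\<close>
    have comb: "P / (D * E) * x\<^sup>2 * t + (K / (D * E * E') * x\<^sup>2 * t
          - R * (t * (U / (D * E) * x) * (V / (D' * E') * x))) =
        P' / (D' * E') * x\<^sup>2 * (t * (U / (D * E) * x))"
      if "P * D' * E' + K * D' - R * (U * V) = P' * U * x" "D \<noteq> 0" "D' \<noteq> 0" "E \<noteq> 0" "E' \<noteq> 0"
      for P P' D D' E E' K R U V x :: complex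
    proof -
      have "P / (D * E) * x\<^sup>2 * t + (K / (D * E * E') * x\<^sup>2 * t
          - R * (t * (U / (D * E) * x) * (V / (D' * E') * x))) =
          (P * D' * E' + K * D' - R * (U * V)) * (x\<^sup>2 * t) / (D * E * D' * E')"
        using that(2-) by (simp add: divide_simps power2_eq_square) (simp add: algebra_simps)
      then show ?thesis unfolding that(1) by (simp add: power2_eq_square mult_ac)
    qed
    have dist: "A * (X + u) - B * (Y + v) = (A * X - B * Y) + (A * u - B * v)" for A B X Y u v :: complex
      by (simp add: algebra_simps)
    have sumS: "(\<Sum>n<Suc N + 2. f n) = (\<Sum>n<N + 2. f n) + f (N + 2)" for f :: "nat \<Rightarrow> complex"
      by simp
    have "(1/3 - a) * (\<Sum>n<Suc N + 2. hyp_term (a + 1) n) - 27/16 * (1/6 - a) * (\<Sum>n<Suc N + 2. hyp_term a n) =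
        ((1/3 - a) * (\<Sum>n<N + 2. hyp_term (a + 1) n) - 27/16 * (1/6 - a) * (\<Sum>n<N + 2. hyp_term a n)) +
        ((1/3 - a) * hyp_term (a + 1) (N + 2) - 27/16 * (1/6 - a) * hyp_term a (N + 2))"
      unfolding sumS by (rule dist)
    also have "\<dots> = cert_poly a (m + 2) / ((4/3 - a + m) * (1 + m)) * (- 1/8)\<^sup>2 * t +
        ((- 1 - 2 * a) * (- 2 * a) * (- 2/3 - 2 * a) * (1/3 - 2 * a) /
          ((4/3 - a + m) * (1 + m) * (2 + m)) * (- 1/8)\<^sup>2 * t -
         27/16 * (1/6 - a) * (t * ((1 - 2 * a + m) * (4/3 - 2 * a + m) /
           ((4/3 - a + m) * (1 + m)) * (- 1/8)) *
          ((2 - 2 * a + m) * (7/3 - 2 * a + m) / ((7/3 - a + m) * (2 + m)) * (- 1/8))))"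
      unfolding Suc.IH 3 2 1 by (simp only: m_def t_def)
    also have "\<dots> = cert_poly a (m + 3) / ((7/3 - a + m) * (2 + m)) * (- 1/8)\<^sup>2 *
        (t * ((1 - 2 * a + m) * (4/3 - 2 * a + m) / ((4/3 - a + m) * (1 + m)) * (- 1/8)))"
      by (rule comb) (use key n in \<open>simp_all add: mult.assoc\<close>)
    also have "\<dots> = cert_poly a (of_nat (Suc N) + 2) / ((4/3 - a + of_nat (Suc N)) * (1 + of_nat (Suc N))) *
        (- 1/8)\<^sup>2 * hyp_term a (Suc N)"
      unfolding 1 by (simp add: m_def algebra_simps)
    finally show ?case .
  qed
qed

lemma lim_ratio: "(\<lambda>n. (u + of_nat n) / (v + of_nat n)) \<longlonglongrightarrow> (1::complex)"
proof -
  have 1: "(\<lambda>n. w / of_nat n + 1) \<longlonglongrightarrow> (1::complex)" for w :: complex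
    using tendsto_add[OF lim_const_over_n[of w] tendsto_const[of 1]] by simp
  have "(\<lambda>n. (u / of_nat n + 1) / (v / of_nat n + 1)) \<longlonglongrightarrow> 1 / (1::complex)"
    by (intro tendsto_divide 1) auto
  moreover have "\<forall>\<^sub>F n in sequentially.
      (u / of_nat n + 1) / (v / of_nat n + 1) = (u + of_nat n) / (v + of_nat n)"
    using eventually_gt_at_top[of 0]
  proof eventually_elim
    case (elim n)
    then have "u / of_nat n + 1 = (u + of_nat n) / of_nat n" "v / of_nat n + 1 = (v + of_nat n) / of_nat n"
      by (simp_all add: field_simps)
    then show ?case using elim by simp
  qed
  ultimately show ?thesis by (simp add: tendsto_cong)
qed

lemma lim_inverse_shift: "(\<lambda>n. 1 / (1 + of_nat n)) \<longlonglongrightarrow> (0::complex)"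
  using LIMSEQ_Suc[OF lim_inverse_n[where ?'a = complex]] by (simp add: divide_inverse)

text \<open>
  The telescoped remainder tends to 0: its rational factor has a finite limit and the
  terms of a convergent series vanish in the limit.
\<close>
lemma hyp_value_rec:
  assumes "1/3 - a \<notin> \<int>\<^sub>\<le>\<^sub>0"
  shows "(1/3 - a) * hyp_value (a + 1) = 27/16 * (1/6 - a) * hyp_value a"
proof -
  have lim: "(\<lambda>N. \<Sum>n<N + 2. hyp_term b n) \<longlonglongrightarrow> hyp_value b" for b
    using LIMSEQ_ignore_initial_segment[OF hyp_term_sums[unfolded sums_def], of b 2] .
  have z: "hyp_term a \<longlonglongrightarrow> 0"
    using hyp_term_sums sums_summable summable_LIMSEQ_zero by blast
  have "(\<lambda>N. ((1/4 - 3/2 * a) * ((1 - 2 * a + of_nat N) / (4/3 - a + of_nat N)) *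
        ((4/3 - 2 * a + of_nat N) / (1 + of_nat N)) +
        2 * a * (2 * a - 1/3) * ((1/3 - 4 * a + of_nat N) / (4/3 - a + of_nat N)) * (1 / (1 + of_nat N)))
        * (- 1/8)\<^sup>2 * hyp_term a N) \<longlonglongrightarrow>
      ((1/4 - 3/2 * a) * 1 * 1 + 2 * a * (2 * a - 1/3) * 1 * 0) * (- 1/8)\<^sup>2 * 0"
    by (intro tendsto_intros lim_ratio z lim_inverse_shift)
  moreover have "cert_poly a (of_nat N + 2) / ((4/3 - a + of_nat N) * (1 + of_nat N)) =
     (1/4 - 3/2 * a) * ((1 - 2 * a + of_nat N) / (4/3 - a + of_nat N)) *
        ((4/3 - 2 * a + of_nat N) / (1 + of_nat N)) +
        2 * a * (2 * a - 1/3) * ((1/3 - 4 * a + of_nat N) / (4/3 - a + of_nat N)) * (1 / (1 + of_nat N))"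
    for N
  proof -
    have "cert_poly a (of_nat N + 2) = (1/4 - 3/2 * a) * (1 - 2 * a + of_nat N) * (4/3 - 2 * a + of_nat N) +
        2 * a * (2 * a - 1/3) * (1/3 - 4 * a + of_nat N)"
      unfolding cert_poly_def by (simp add: algebra_simps)
    moreover have "(X * u * v + Y * w) / (D * E) = X * (u / D) * (v / E) + Y * (w / D) * (1 / E)"
      for X Y u v w D E :: complex
      by (simp add: add_divide_distrib)
    ultimately show ?thesis by (simp only:)
  qed
  ultimately have "(\<lambda>N. cert_poly a (of_nat N + 2) / ((4/3 - a + of_nat N) * (1 + of_nat N)) * (- 1/8)\<^sup>2 * hyp_term a N)
      \<longlonglongrightarrow> 0" by simp
  moreover have "(\<lambda>N. (1/3 - a) * (\<Sum>n<N + 2. hyp_term (a + 1) n) - 27/16 * (1/6 - a) * (\<Sum>n<N + 2. hyp_term a n))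
      \<longlonglongrightarrow> (1/3 - a) * hyp_value (a + 1) - 27/16 * (1/6 - a) * hyp_value a"
    by (intro tendsto_intros lim)
  ultimately have "(1/3 - a) * hyp_value (a + 1) - 27/16 * (1/6 - a) * hyp_value a = 0"
    unfolding telescoped_sum[OF assms] by (rule LIMSEQ_unique[rotated])
  then show ?thesis by simp
qed

section \<open>Entire functions of small exponential type\<close>

lemma holomorphic_quotient_simple_zeros:
  assumes u: "u holomorphic_on UNIV" and v: "v holomorphic_on UNIV"
    and zero: "\<And>z. v z = 0 \<Longrightarrow> u z = 0 \<and> deriv v z \<noteq> 0"
  obtains q where "q holomorphic_on UNIV" "\<And>z. u z = q z * v z"
proof -
  define q where "q = (\<lambda>z. if v z = 0 then deriv u z / deriv v z else u z / v z)"
  have du: "((\<lambda>w. (u w - u z) / (w - z)) \<longlongrightarrow> deriv u z) (at z)" for z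
    using holomorphic_derivI[OF u open_UNIV, of z] by (simp add: has_field_derivative_iff)
  have dv: "((\<lambda>w. (v w - v z) / (w - z)) \<longlongrightarrow> deriv v z) (at z)" for z
    using holomorphic_derivI[OF v open_UNIV, of z] by (simp add: has_field_derivative_iff)
  have hol: "q holomorphic_on {z. v z \<noteq> 0}"
  proof -
    have "(\<lambda>z. u z / v z) holomorphic_on {z. v z \<noteq> 0}"
      using u v by (intro holomorphic_intros) (auto intro: holomorphic_on_subset)
    then show ?thesis by (rule holomorphic_transform) (auto simp: q_def)
  qed
  have op: "open {z. v z \<noteq> 0}"
    using holomorphic_on_imp_continuous_on[OF v] by (intro open_Collect_neq) auto
  have "q field_differentiable at z" for z
  proof (cases "v z = 0")
    case False
    then show ?thesis using hol op holomorphic_on_imp_differentiable_at by blast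
  next
    case True
    note z = zero[OF True]
    have "\<forall>\<^sub>F w in at z. (v w - v z) / (w - z) \<noteq> 0"
      using tendsto_imp_eventually_ne[OF dv] z by blast
    then have ev: "\<forall>\<^sub>F w in at z. v w \<noteq> 0"
      by eventually_elim (use True in auto)
    then obtain d where d: "d > 0" "\<And>w. w \<noteq> z \<Longrightarrow> dist w z < d \<Longrightarrow> v w \<noteq> 0"
      unfolding eventually_at by blast
    have holp: "q holomorphic_on (ball z d - {z})"
      by (rule holomorphic_on_subset[OF hol]) (use d in \<open>auto simp: dist_commute\<close>)
    \<comment> \<open>The rule of l'Hopital makes the quotient continuous at the zero, hence the singularity removable.\<close>
    have "((\<lambda>w. ((u w - u z) / (w - z)) / ((v w - v z) / (w - z))) \<longlongrightarrow> deriv u z / deriv v z) (at z)"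
      using z by (intro tendsto_divide du dv) auto
    moreover have "\<forall>\<^sub>F w in at z. ((u w - u z) / (w - z)) / ((v w - v z) / (w - z)) = q w"
      using ev eventually_neq_at_within[of z] by eventually_elim (use True z in \<open>auto simp: q_def\<close>)
    ultimately have "(q \<longlongrightarrow> q z) (at z)"
      using True by (simp add: q_def tendsto_cong)
    then have "isCont q z" by (simp add: isCont_def)
    moreover have "isCont q w" if "w \<in> ball z d - {z}" for w
      using holomorphic_on_imp_continuous_on[OF holp] that
      by (simp add: continuous_on_eq_continuous_at open_delete)
    ultimately have "continuous_on (ball z d) q"
      by (metis Diff_iff continuous_at_imp_continuous_on singletonD)
    then have "q holomorphic_on ball z d"
      by (rule no_isolated_singularity[where K = "{z}"]) (use holp in auto)
    then show ?thesis
      using d(1) holomorphic_on_imp_differentiable_at by (metis centre_in_ball open_ball)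
  qed
  then have "q holomorphic_on UNIV" by (simp add: holomorphic_on_def field_differentiable_at_within)
  moreover have "u z = q z * v z" for z using zero[of z] by (auto simp: q_def)
  ultimately show thesis by (rule that)
qed

text \<open>
  On the lines \<open>Re z \<in> 1/2 + \<int>\<close> the modulus of the sine is \<open>cosh (\<pi> Im z)\<close>; elsewhere it is at
  least \<open>\<bar>sinh (\<pi> Im z)\<bar>\<close>, which is large away from the real axis.
\<close>
lemma norm_sin_pi_ge:
  assumes "1 \<le> \<bar>Im z\<bar> \<or> (\<exists>n::int. Re z = of_int n + 1/2)"
  shows "exp (pi * \<bar>Im z\<bar>) / 4 \<le> norm (sin (of_real pi * z))"
proof -
  define E where "E = exp (2 * (pi * \<bar>Im z\<bar>))"
  have E: "E > 0" by (simp add: E_def)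
  have "exp (2 * (pi * Im z)) + inverse (exp (2 * (pi * Im z))) = E + inverse E"
    by (cases "Im z \<ge> 0") (auto simp: E_def exp_minus)
  then have eq: "(norm (sin (of_real pi * z)))\<^sup>2 = (E + inverse E - 2 * cos (2 * (pi * Re z))) / 4"
    unfolding norm_sin_squared by simp
  have "E / 16 \<le> (E + inverse E - 2 * cos (2 * (pi * Re z))) / 4"
    using assms
  proof
    assume "1 \<le> \<bar>Im z\<bar>"
    then have "3 * 1 \<le> pi * \<bar>Im z\<bar>"
      using pi_gt3 by (intro mult_mono) auto
    then have "6 \<le> E" unfolding E_def using exp_ge_add_one_self[of "2 * (pi * \<bar>Im z\<bar>)"] by linarith
    moreover have "0 < inverse E" "cos (2 * (pi * Re z)) \<le> 1" using E by auto
    moreover have "e / 16 \<le> (e + i - 2 * k) / 4" if "6 \<le> e" "0 < i" "k \<le> 1" for e i k :: real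
      using that by (simp add: field_simps)
    ultimately show ?thesis by blast
  next
    assume "\<exists>n::int. Re z = of_int n + 1/2"
    then obtain n :: int where n: "Re z = of_int n + 1/2" ..
    have "cos (2 * (pi * Re z)) = cos (2 * pi * of_int n + pi)"
      unfolding n by (simp add: algebra_simps)
    also have "\<dots> = - 1"
      by (metis cos_int_2pin cos_periodic_pi mult.commute mult.left_commute)
    finally have "cos (2 * (pi * Re z)) = - 1" .
    moreover have "0 < inverse E" using E by simp
    ultimately show ?thesis using E by simp
  qed
  moreover have "(exp (pi * \<bar>Im z\<bar>) / 4)\<^sup>2 = E / 16"
    by (simp add: E_def power2_eq_square flip: exp_add)
  ultimately show ?thesis
    unfolding eq[symmetric] by (metis norm_ge_zero power2_le_imp_le)
qed

text \<open>
  A weak form of Carlson's theorem. The function \<open>q = f / sin (\<pi> z)\<close> is entire; it is bounded for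
  \<open>Re z \<in> 1/2 + \<int>\<close> and for \<open>\<bar>Im z\<bar> \<ge> 1\<close>, where the sine is of size \<open>exp (\<pi> \<bar>Im z\<bar>)\<close>, and hence
  everywhere, by the maximum principle on the boxes that remain. By Liouville it is constant,
  and since \<open>c < \<pi>\<close> it tends to 0 along the imaginary axis.
\<close>
lemma entire_vanishing_on_Ints_eq_0:
  assumes f: "f holomorphic_on UNIV" and zero: "\<And>n::int. f (of_int n) = 0"
    and bound: "\<And>z. norm (f z) \<le> C * exp (c * \<bar>Im z\<bar>)" and c: "c < pi"
  shows "f z = 0"
proof -
  have C: "0 \<le> C" using order_trans[OF norm_ge_zero bound[of 0]] by simp
  define v where "v = (\<lambda>z. sin (complex_of_real pi * z))"
  have dv: "deriv v z = of_real pi * cos (of_real pi * z)" for z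
    unfolding v_def by (rule DERIV_imp_deriv) (auto intro!: derivative_eq_intros)
  have "v holomorphic_on UNIV" unfolding v_def by (intro holomorphic_intros)
  moreover have "f z = 0 \<and> deriv v z \<noteq> 0" if vz: "v z = 0" for z
  proof
    obtain n :: int where "of_real pi * z = of_real (n * pi)"
      using vz unfolding v_def sin_eq_0 by blast
    then have "z = of_int n" by simp
    then show "f z = 0" by (simp add: zero)
    show "deriv v z \<noteq> 0"
    proof
      assume "deriv v z = 0"
      then have "cos (of_real pi * z) = 0" by (simp add: dv)
      moreover have "sin (of_real pi * z) = 0" using vz by (simp add: v_def)
      ultimately show False using sin_cos_squared_add[of "of_real pi * z"] by (simp only:) simp
    qed
  qed
  ultimately obtain q where q: "q holomorphic_on UNIV" and fq: "\<And>z. f z = q z * v z"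
    using holomorphic_quotient_simple_zeros[OF f] by blast
  have good: "norm (q z) \<le> 4 * C * exp ((c - pi) * \<bar>Im z\<bar>)"
    if "1 \<le> \<bar>Im z\<bar> \<or> (\<exists>n::int. Re z = of_int n + 1/2)" for z
  proof -
    have "norm (q z) * (exp (pi * \<bar>Im z\<bar>) / 4) \<le> norm (q z) * norm (v z)"
      unfolding v_def by (intro mult_left_mono norm_sin_pi_ge that) auto
    also have "\<dots> \<le> C * exp (c * \<bar>Im z\<bar>)" using bound[of z] by (simp add: fq norm_mult)
    finally show ?thesis by (simp add: left_diff_distrib exp_diff field_simps)
  qed
  have good': "norm (q z) \<le> 4 * C" if "1 \<le> \<bar>Im z\<bar> \<or> (\<exists>n::int. Re z = of_int n + 1/2)" for z
  proof -
    have "exp ((c - pi) * \<bar>Im z\<bar>) \<le> 1" using c by (simp add: mult_nonpos_nonneg)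
    then show ?thesis using good[OF that] C by (smt (verit) mult_left_le mult_nonneg_nonneg)
  qed
  have all: "norm (q z) \<le> 4 * C" for z
  proof (cases "1 \<le> \<bar>Im z\<bar>")
    case True then show ?thesis using good' by blast
  next
    case False
    define n where "n = \<lfloor>Re z + 1/2\<rfloor>"
    define R where "R = cbox (Complex (of_int (n - 1) + 1/2) (- 1)) (Complex (of_int n + 1/2) 1)"
    have zR: "z \<in> R"
      using False unfolding R_def n_def by (auto simp: in_cbox_complex_iff) linarith+
    show ?thesis
    proof (rule maximum_modulus_frontier[where f = q and S = R])
      show "q holomorphic_on interior R" using q holomorphic_on_subset by blast
      show "continuous_on (closure R) q"
        using q holomorphic_on_imp_continuous_on continuous_on_subset by blast
      show "bounded R" by (simp add: R_def)
      show "z \<in> R" by (fact zR)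
      fix w assume "w \<in> frontier R"
      then have "w \<in> R" "w \<notin> box (Complex (of_int (n - 1) + 1/2) (- 1)) (Complex (of_int n + 1/2) 1)"
        by (auto simp: R_def frontier_cbox)
      then have "1 \<le> \<bar>Im w\<bar> \<or> Re w = of_int (n - 1) + 1/2 \<or> Re w = of_int n + 1/2"
        by (auto simp: R_def in_cbox_complex_iff in_box_complex_iff)
      then show "norm (q w) \<le> 4 * C" using good' by blast
    qed
  qed
  then have "bounded (range q)" by (auto simp: bounded_iff)
  then obtain k where k: "\<And>z. q z = k"
    using Liouville_theorem[OF q] by (auto simp: constant_on_def)
  have "k = 0"
  proof -
    have "norm k \<le> 4 * C * exp ((c - pi) * real n)" if "n \<ge> 1" for n :: nat
      using good[of "Complex 0 (real n)"] that by (simp add: k)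
    then have "\<forall>\<^sub>F n in sequentially. norm k \<le> 4 * C * exp ((c - pi) * real n)"
      unfolding eventually_sequentially by blast
    moreover have "(\<lambda>n. 4 * C * exp ((c - pi) * real n)) \<longlonglongrightarrow> 4 * C * 0"
    proof (intro tendsto_intros)
      have "(\<lambda>n. exp (c - pi) ^ n) \<longlonglongrightarrow> 0"
        using c by (intro LIMSEQ_realpow_zero) auto
      then show "(\<lambda>n. exp ((c - pi) * real n)) \<longlonglongrightarrow> 0"
        by (simp add: exp_of_nat2_mult)
    qed
    ultimately have "norm k \<le> 4 * C * 0"
      using tendsto_lowerbound trivial_limit_sequentially by blast
    then show ?thesis by simp
  qed
  then show ?thesis by (simp add: fq k)
qed

text \<open>
  Any integer translate that moves a point into the half plane may be used to define the extension;
  periodicity makes the choice irrelevant, and a fixed translate serves near a given point.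
\<close>
lemma periodic_half_plane_extension:
  assumes h: "h holomorphic_on {z. Re z < r}"
    and per: "\<And>z. Re z + 1 < r \<Longrightarrow> h (z + 1) = h z"
  obtains f where "f holomorphic_on UNIV" "\<And>z (k::int). Re z - of_int k < r \<Longrightarrow> f z = h (z - of_int k)"
proof -
  have per_nat: "h (z - of_nat n) = h z" if "Re z < r" for z n
  proof (induction n)
    case (Suc n)
    have "h (z - of_nat (Suc n) + 1) = h (z - of_nat (Suc n))"
      using that by (intro per) simp
    then show ?case using Suc by (simp add: algebra_simps)
  qed simp
  have per_int: "h (z - of_int l) = h (z - of_int k)"
    if "Re z - of_int k < r" "k \<le> l" for z and k l :: int
  proof -
    have "h (z - of_int k - of_nat (nat (l - k))) = h (z - of_int k)"
      using that by (intro per_nat) simp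
    moreover have "(of_nat (nat (l - k)) :: complex) = of_int (l - k)" using that by simp
    ultimately show ?thesis by simp
  qed
  define f where "f z = h (z - of_int (\<lceil>Re z - r\<rceil> + 1))" for z
  have f_eq: "f z = h (z - of_int k)" if "Re z - of_int k < r" for z and k :: int
  proof -
    have "Re z - of_int (\<lceil>Re z - r\<rceil> + 1) < r" by linarith
    then show ?thesis
      unfolding f_def using per_int[of z] that by (metis linorder_linear)
  qed
  have "f field_differentiable at z" for z
  proof -
    define k where "k = \<lceil>Re z - r\<rceil> + 1"
    define U where "U = {w. Re w < r + of_int k}"
    have "open U" "z \<in> U" unfolding U_def k_def by (auto intro: open_halfspace_Re_lt) linarith
    moreover have "f holomorphic_on U"
    proof (rule holomorphic_transform)
      have "(h \<circ> (\<lambda>w. w - of_int k)) holomorphic_on U"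
        by (rule holomorphic_on_compose_gen[OF _ h]) (auto simp: U_def intro!: holomorphic_intros)
      then show "(\<lambda>w. h (w - of_int k)) holomorphic_on U" by (simp add: o_def)
      fix w assume "w \<in> U"
      then show "h (w - of_int k) = f w" by (intro f_eq[symmetric]) (simp add: U_def)
    qed
    ultimately show ?thesis using holomorphic_on_imp_differentiable_at by blast
  qed
  then have "f holomorphic_on UNIV" by (simp add: holomorphic_on_def field_differentiable_at_within)
  then show thesis using f_eq by (rule that)
qed

section \<open>Growth of the series\<close>

lemma binomial_majorant:
  fixes b :: real
  shows "(\<lambda>n. pochhammer b n / fact n * (1/4) ^ n) sums ((4/3) powr b)"
proof -
  have "(\<lambda>n. ((- b) gchoose n) * (- 1/4) ^ n) sums (1 + (- 1/4)) powr (- b)"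
    by (rule gen_binomial_real) simp
  moreover have "((- b) gchoose n) * (- 1/4) ^ n = pochhammer b n / fact n * (1/4) ^ n" for n
  proof -
    have "(- 1) ^ n * (- 1/4 :: real) ^ n = (1/4) ^ n" by (simp flip: power_mult_distrib)
    then show ?thesis by (simp add: gbinomial_pochhammer mult_ac)
  qed
  moreover have "(1 + (- 1/4)) powr (- b) = (4/3 :: real) powr b"
    by (simp add: powr_minus powr_divide)
  ultimately show ?thesis by simp
qed

text \<open>
  The imaginary parts on the two sides agree, so only the real parts matter. This
  is where the half plane \<open>Re a \<le> 11/12\<close> comes from: for \<open>n = 0\<close> and \<open>1 - 2 Re a < 0\<close> the bound
  reads \<open>4 Re a \<le> 11/3\<close>. The half plane contains the point \<open>1/2\<close> at which the value is known.
\<close>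
lemma norm_numerator_le:
  assumes "Re a \<le> 11/12"
  shows "norm (1 - 2 * a + of_nat n) \<le> 2 * norm (4/3 - a + of_nat n)"
proof -
  have "\<bar>1 - 2 * Re a + real n\<bar> \<le> 2 * \<bar>4/3 - Re a + real n\<bar>"
  proof -
    have "\<bar>4/3 - Re a + real n\<bar> = 4/3 - Re a + real n"
      using assms by (intro abs_of_nonneg) simp
    then show ?thesis using assms by (simp add: abs_le_iff)
  qed
  then have "\<bar>1 - 2 * Re a + real n\<bar>\<^sup>2 \<le> (2 * \<bar>4/3 - Re a + real n\<bar>)\<^sup>2"
    by (intro power_mono) auto
  then have "(norm (1 - 2 * a + of_nat n))\<^sup>2 \<le> (2 * norm (4/3 - a + of_nat n))\<^sup>2"
    by (simp add: cmod_power2 power_mult_distrib)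
  then show ?thesis by (rule power2_le_imp_le) simp
qed

text \<open>
  In the ratio of consecutive terms the factor \<open>(1 - 2a + n) / (4/3 - a + n)\<close> costs at most 2, so
  the argument \<open>1/8\<close> becomes \<open>1/4\<close> and a binomial series in \<open>\<bar>4/3 - 2a\<bar>\<close> is left.
\<close>
lemma norm_hyp_term_le:
  assumes "Re a \<le> 11/12"
  shows "norm (hyp_term a n) \<le> pochhammer (norm (4/3 - 2 * a)) n / fact n * (1/4) ^ n"
proof (induction n)
  case (Suc n)
  define b where "b = norm (4/3 - 2 * a)"
  have cpos: "norm (4/3 - a + of_nat n) > 0"
  proof -
    have "Re (4/3 - a + of_nat n) > 0" using assms by simp
    then show ?thesis using complex_Re_le_cmod less_le_trans by blast
  qed
  have "norm (1 - 2 * a + of_nat n) / norm (4/3 - a + of_nat n) \<le> 2"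
    using norm_numerator_le[OF assms, of n] cpos by (simp add: field_simps)
  moreover have "norm (4/3 - 2 * a + of_nat n) \<le> b + real n"
    using norm_triangle_ineq[of "4/3 - 2 * a" "of_nat n"] by (simp add: b_def)
  ultimately have "norm (1 - 2 * a + of_nat n) / norm (4/3 - a + of_nat n) *
      (norm (4/3 - 2 * a + of_nat n) / (8 * (1 + real n))) \<le> 2 * ((b + real n) / (8 * (1 + real n)))"
    by (intro mult_mono divide_right_mono) auto
  also have "\<dots> = (b + real n) / (1 + real n) * (1/4)"
    by (simp add: field_simps)
  finally have ratio: "norm (1 - 2 * a + of_nat n) / norm (4/3 - a + of_nat n) *
      (norm (4/3 - 2 * a + of_nat n) / (8 * (1 + real n))) \<le> (b + real n) / (1 + real n) * (1/4)" .
  have pos: "0 \<le> pochhammer b n" unfolding pochhammer_prod by (intro prod_nonneg) (simp add: b_def)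
  have n1: "norm (1 + of_nat n :: complex) = 1 + real n"
    by (metis norm_of_nat of_nat_Suc)
  have "norm (hyp_term a (Suc n)) = norm (hyp_term a n) * (norm (1 - 2 * a + of_nat n) / norm (4/3 - a + of_nat n) *
      (norm (4/3 - 2 * a + of_nat n) / (8 * (1 + real n))))"
    unfolding hyp_term_Suc norm_mult norm_divide n1 by simp
  also have "\<dots> \<le> (pochhammer b n / fact n * (1/4) ^ n) * ((b + real n) / (1 + real n) * (1/4))"
  proof (rule mult_mono[OF _ ratio])
    show "norm (hyp_term a n) \<le> pochhammer b n / fact n * (1/4) ^ n"
      using Suc.IH by (simp add: b_def)
  qed (use pos in auto)
  also have "\<dots> = pochhammer b (Suc n) / fact (Suc n) * (1/4) ^ Suc n"
    by (simp add: pochhammer_Suc field_simps)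
  finally show ?case by (simp add: b_def)
qed simp

lemma norm_hyp_value_le:
  assumes "Re a \<le> 11/12"
  shows "norm (hyp_value a) \<le> (4/3) powr norm (4/3 - 2 * a)"
proof -
  have "norm (suminf (hyp_term a)) \<le> (\<Sum>n. pochhammer (norm (4/3 - 2 * a)) n / fact n * (1/4) ^ n)"
    by (intro norm_suminf_le norm_hyp_term_le assms sums_summable[OF binomial_majorant])
  then show ?thesis
    using hyp_term_sums[of a] binomial_majorant[of "norm (4/3 - 2 * a)"] by (simp add: sums_iff)
qed

text \<open>
  The majorant increases with \<open>\<bar>4/3 - 2a\<bar>\<close>, so its value at a bound for this number serves in
  the Weierstrass test on a disc.
\<close>
lemma hyp_value_holomorphic: "hyp_value holomorphic_on {a. Re a < 11/12}"
proof (rule holomorphic_uniform_sequence)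
  show op: "open {a. Re a < 11/12}" by (rule open_halfspace_Re_lt)
  show "(\<lambda>a. \<Sum>i<n. hyp_term a i) holomorphic_on {a. Re a < 11/12}" for n
  proof -
    have nz: "pochhammer (4/3 - a) i \<noteq> 0" if "Re a < 11/12" for a :: complex and i
    proof
      assume "pochhammer (4/3 - a) i = 0"
      then obtain k where "4/3 - a = - of_nat k" by (auto simp: pochhammer_eq_0_iff)
      then have "Re (4/3 - a) = - real k" by simp
      then show False using that by simp
    qed
    have poch: "(\<lambda>a. pochhammer (f a) i) holomorphic_on A" if "f holomorphic_on A"
      for f :: "complex \<Rightarrow> complex" and A i
      unfolding pochhammer_prod using that by (intro holomorphic_intros)
    show ?thesis
      unfolding hyp_term_def
      by (intro holomorphic_intros poch) (use nz in \<open>auto simp: pochhammer_fact simp flip: pochhammer_fact\<close>)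
  qed
  fix a :: complex assume "a \<in> {a. Re a < 11/12}"
  then obtain d where d: "d > 0" "cball a d \<subseteq> {a. Re a < 11/12}"
    using op open_contains_cball by blast
  have "uniform_limit (cball a d) (\<lambda>n w. \<Sum>i<n. hyp_term w i) (\<lambda>w. suminf (hyp_term w)) sequentially"
  proof (rule Weierstrass_m_test)
    define B where "B = norm (4/3 - 2 * a) + 2 * d"
    show "summable (\<lambda>n. pochhammer B n / fact n * (1/4) ^ n)"
      by (rule sums_summable[OF binomial_majorant])
    fix n w assume w: "w \<in> cball a d"
    have "norm (4/3 - 2 * w) = norm ((4/3 - 2 * a) + 2 * (a - w))" by (simp add: algebra_simps)
    also have "\<dots> \<le> norm (4/3 - 2 * a) + norm (2 * (a - w))" by (rule norm_triangle_ineq)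
    also have "\<dots> \<le> B" using w unfolding B_def norm_mult by (simp add: dist_norm)
    finally have le: "norm (4/3 - 2 * w) \<le> B" .
    have "pochhammer (norm (4/3 - 2 * w)) n \<le> pochhammer B n"
      unfolding pochhammer_prod using le by (intro prod_mono) auto
    then have "pochhammer (norm (4/3 - 2 * w)) n / fact n * (1/4) ^ n \<le> pochhammer B n / fact n * (1/4) ^ n"
      by (intro mult_right_mono divide_right_mono) auto
    moreover have "norm (hyp_term w n) \<le> pochhammer (norm (4/3 - 2 * w)) n / fact n * (1/4) ^ n"
      using d w by (intro norm_hyp_term_le) force
    ultimately show "norm (hyp_term w n) \<le> pochhammer B n / fact n * (1/4) ^ n" by linarith
  qed
  moreover have "suminf (hyp_term w) = hyp_value w" for w using hyp_term_sums by (simp add: sums_iff)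
  ultimately show "\<exists>d>0. cball a d \<subseteq> {a. Re a < 11/12} \<and>
      uniform_limit (cball a d) (\<lambda>n a. \<Sum>i<n. hyp_term a i) hyp_value sequentially"
    using d by auto
qed

lemma hyp_value_half: "hyp_value (1/2) = 1"
proof -
  have "hyp_term (1/2) = (\<lambda>n. if n = 0 then 1 else 0)"
  proof
    show "hyp_term (1/2) n = (if n = 0 then 1 else 0)" for n
      by (cases n) (simp_all add: hyp_term_def pochhammer_rec)
  qed
  then have "hyp_term (1/2) sums 1" using sums_single[of 0 "\<lambda>_. 1::complex"] by simp
  then show ?thesis using hyp_term_sums sums_unique2 by blast
qed

section \<open>The Gamma quotient\<close>

text \<open>
  For complex \<open>z\<close> the quotient \<open>\<bar>\<Gamma>(z) / \<Gamma>(z + s)\<bar>\<close> is at most its value at a positive real number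
  \<open>x \<le> Re z\<close>, because in the product formula of Gauss each factor satisfies
  \<open>\<bar>(z + s + k) / (z + k)\<bar> \<le> 1 + s / \<bar>z + k\<bar> \<le> (x + s + k) / (x + k)\<close>.
\<close>
lemma norm_rGamma_shift_le:
  fixes z :: complex and x s :: real
  assumes x: "0 < x" "x \<le> Re z" and s: "0 \<le> s"
  shows "norm (rGamma (z + of_real s)) * rGamma x \<le> norm (rGamma z) * rGamma (x + s)"
proof (rule LIMSEQ_le)
  show "(\<lambda>n. norm (rGamma_series (z + of_real s) n) * rGamma_series x n) \<longlonglongrightarrow>
      norm (rGamma (z + of_real s)) * rGamma x"
    by (intro tendsto_intros)
  show "(\<lambda>n. norm (rGamma_series z n) * rGamma_series (x + s) n) \<longlonglongrightarrow> norm (rGamma z) * rGamma (x + s)"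
    by (intro tendsto_intros)
  have poch: "norm (pochhammer (z + of_real s) n) * pochhammer x n \<le>
      norm (pochhammer z n) * pochhammer (x + s) n" for n
  proof (induction n)
    case (Suc n)
    have "norm (z + of_real s + of_nat n) \<le> norm (z + of_nat n) + s"
      using norm_triangle_ineq[of "z + of_nat n" "of_real s"] s by (simp add: add_ac)
    moreover have ge: "x + real n \<le> norm (z + of_nat n)"
      using complex_Re_le_cmod[of "z + of_nat n"] x by simp
    ultimately have "norm (z + of_real s + of_nat n) * (x + real n) \<le> (norm (z + of_nat n) + s) * (x + real n)"
      using x by (intro mult_right_mono) auto
    also have "\<dots> \<le> norm (z + of_nat n) * (x + s + real n)"
      using mult_left_mono[OF ge s] by (simp add: algebra_simps)
    finally have step: "norm (z + of_real s + of_nat n) * (x + real n) \<le>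
        norm (z + of_nat n) * (x + s + real n)" .
    have "(norm (pochhammer (z + of_real s) n) * pochhammer x n) *
          (norm (z + of_real s + of_nat n) * (x + real n)) \<le>
        (norm (pochhammer z n) * pochhammer (x + s) n) * (norm (z + of_nat n) * (x + s + real n))"
      using x s by (intro mult_mono Suc.IH step mult_nonneg_nonneg pochhammer_nonneg) auto
    then show ?case by (simp add: pochhammer_Suc norm_mult mult_ac)
  qed simp
  have "norm (rGamma_series (z + of_real s) n) * rGamma_series x n \<le>
      norm (rGamma_series z n) * rGamma_series (x + s) n" for n
  proof -
    define e where "e = fact n * fact n * exp ((Re z + s + x) * ln (real n))"
    have e: "e > 0" by (simp add: e_def)
    have "norm (rGamma_series (z + of_real s) n) * rGamma_series x n =
        norm (pochhammer (z + of_real s) (n + 1)) * pochhammer x (n + 1) / e"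
      by (simp add: rGamma_series_def norm_divide norm_mult e_def exp_add [symmetric] ring_distribs)
    moreover have "norm (rGamma_series z n) * rGamma_series (x + s) n =
        norm (pochhammer z (n + 1)) * pochhammer (x + s) (n + 1) / e"
      by (simp add: rGamma_series_def norm_divide norm_mult e_def exp_add [symmetric] ring_distribs add_ac)
    ultimately show ?thesis
      using poch[of "n + 1"] e by (simp add: divide_right_mono)
  qed
  then show "\<exists>N. \<forall>n\<ge>N. norm (rGamma_series (z + of_real s) n) * rGamma_series x n \<le>
      norm (rGamma_series z n) * rGamma_series (x + s) n" by blast
qed

definition gamma_value :: "complex \<Rightarrow> complex" where
  "gamma_value a = (3 powr (3 * a - 2) * complex_of_real (sqrt pi) * Gamma (4/3 - a)) /
    (2 powr (4 * a - 8/3) * Gamma (2/3)) * rGamma (7/6 - a)"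

lemma gamma_value_rec:
  assumes "1/3 - a \<notin> \<int>\<^sub>\<le>\<^sub>0"
  shows "(1/3 - a) * gamma_value (a + 1) = 27/16 * (1/6 - a) * gamma_value a"
proof -
  have 1: "(3::complex) powr (3 * (a + 1) - 2) = 27 * 3 powr (3 * a - 2)"
  proof -
    have "3 * (a + 1) - 2 = (3 * a - 2) + of_nat 3" by (simp add: algebra_simps)
    then show ?thesis by (simp only: powr_add powr_nat) simp
  qed
  have 2: "(2::complex) powr (4 * (a + 1) - 8/3) = 16 * 2 powr (4 * a - 8/3)"
  proof -
    have "4 * (a + 1) - 8/3 = (4 * a - 8/3) + of_nat 4" by (simp add: algebra_simps)
    then show ?thesis by (simp only: powr_add powr_nat) simp
  qed
  have 3: "Gamma (4/3 - a) = (1/3 - a) * Gamma (4/3 - (a + 1))"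
    using Gamma_plus1[OF assms] by (simp add: algebra_simps)
  have 4: "rGamma (7/6 - (a + 1)) = (1/6 - a) * rGamma (7/6 - a)"
    using rGamma_plus1[of "1/6 - a"] by (simp add: algebra_simps)
  have "c * (27 * p * q * G / (16 * t * g) * (d * r)) = 27/16 * d * (p * q * (c * G) / (t * g) * r)"
    for c d p q G t g r :: complex by (simp add: mult_ac)
  then show ?thesis unfolding gamma_value_def 1 2 3 4 .
qed

lemma nonpos_Int_Re: "z \<notin> \<int>\<^sub>\<le>\<^sub>0" if "Re z > 0"
  using that by (auto elim!: nonpos_Ints_cases)

lemma nonzero_Re: "z \<noteq> 0" if "Re z > 0"
  using that by auto

text \<open>
  After cancelling powers of 2 and 3, the claim is \<open>\<Gamma>(1/3) \<Gamma>(5/6) = 2 powr (1/3) sqrt \<pi> \<Gamma>(2/3)\<close>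
  (duplication) combined with \<open>\<Gamma>(1/3) \<Gamma>(2/3) = 2 \<pi> / sqrt 3\<close> (reflection).
\<close>
lemma gamma_value_half: "gamma_value (1/2) = 1"
proof -
  have nz: "Gamma (1/3 :: complex) \<noteq> 0" "Gamma (2/3 :: complex) \<noteq> 0"
    using nonpos_Int_Re[of "1/3"] nonpos_Int_Re[of "2/3"] by (simp_all add: Gamma_eq_zero_iff)
  have dup: "Gamma (1/3 :: complex) * Gamma (5/6) = 2 powr (1/3) * of_real (sqrt pi) * Gamma (2/3)"
  proof -
    have "1/3 \<notin> (\<int>\<^sub>\<le>\<^sub>0 :: complex set)" "1/3 + 1/2 \<notin> (\<int>\<^sub>\<le>\<^sub>0 :: complex set)"
      using nonpos_Int_Re[of "1/3"] nonpos_Int_Re[of "1/3 + 1/2"] by simp_all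
    moreover have "exp ((1 - 2 * (1/3)) * of_real (ln 2)) = (2::complex) powr (1/3)"
      using Ln_of_real[of 2] by (simp add: powr_def)
    ultimately show ?thesis using Gamma_legendre_duplication[of "1/3"] by simp
  qed
  have refl: "Gamma (1/3 :: complex) * Gamma (2/3) = 2 * of_real pi / of_real (sqrt 3)"
  proof -
    have "sin (complex_of_real pi * (1/3)) = of_real (sqrt 3 / 2)"
      using sin_of_real[of "pi / 3", where ?'a = complex] by (simp add: sin_60)
    from Gamma_reflection_complex[of "1/3", unfolded this] show ?thesis by simp
  qed
  have p3: "(3::complex) powr (- 1/2) = 1 / of_real (sqrt 3)"
  proof -
    have "(3::complex) powr (- 1/2) = of_real (3 powr (- 1/2))"
      using powr_of_real[of 3 "- 1/2"] by simp
    also have "3 powr (- 1/2) = 1 / sqrt (3::real)"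
      by (simp add: powr_minus_divide powr_half_sqrt)
    finally show ?thesis by simp
  qed
  have p2: "(2::complex) powr (1/3) = 2 * 2 powr (- 2/3)"
    using powr_add[of "2::complex" 1 "- 2/3"] by simp
  have p2nz: "(2::complex) powr (- 2/3) \<noteq> 0" by simp
  have pi: "complex_of_real (sqrt pi) * of_real (sqrt pi) = of_real pi"
    by (simp flip: of_real_mult)
  have s3: "complex_of_real (sqrt 3) \<noteq> 0" by simp
  have "gamma_value (1/2) =
      3 powr (- 1/2) * of_real (sqrt pi) * Gamma (5/6) / (2 powr (- 2/3) * Gamma (2/3)) / Gamma (2/3)"
  proof -
    have "3 * (1/2) - 2 = (- 1/2 :: complex)" "4 * (1/2) - 8/3 = (- 2/3 :: complex)"
      "4/3 - 1/2 = (5/6 :: complex)" "7/6 - 1/2 = (2/3 :: complex)" by simp_all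
    then show ?thesis unfolding gamma_value_def rGamma_inverse_Gamma by (simp only: divide_inverse)
  qed
  also have "\<dots> = of_real (sqrt pi) * (Gamma (1/3) * Gamma (5/6)) /
      (of_real (sqrt 3) * 2 powr (- 2/3) * (Gamma (1/3) * Gamma (2/3)) * Gamma (2/3))"
  proof -
    have "1 / s * r * z / (t * y) / y = r * (x * z) / (s * t * (x * y) * y)"
      if "x \<noteq> 0" for x y z r s t :: complex
      using that by (simp add: mult_ac)
    then show ?thesis unfolding p3 using nz(1) .
  qed
  also have "\<dots> = (of_real (sqrt pi) * of_real (sqrt pi)) / of_real pi"
  proof -
    have "r * (2 * t * r * y) / (s * t * (2 * p / s) * y) = r * r / p"
      if "y \<noteq> 0" "t \<noteq> 0" "s \<noteq> 0" for y t s r p :: complex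
      using that by (simp add: field_simps)
    then show ?thesis unfolding dup refl p2 using nz(2) p2nz s3 .
  qed
  also have "\<dots> = 1" unfolding pi by simp
  finally show ?thesis .
qed

lemma gamma_value_nonzero: "gamma_value a \<noteq> 0" if "Re a < 7/6"
proof -
  have "Gamma (4/3 - a) \<noteq> 0" "rGamma (7/6 - a) \<noteq> 0" "Gamma (2/3 :: complex) \<noteq> 0"
    using that by (auto simp: Gamma_eq_zero_iff rGamma_eq_zero_iff intro!: nonpos_Int_Re dest: nonpos_Int_Re[rotated])
  then show ?thesis by (simp add: gamma_value_def)
qed

lemma gamma_value_holomorphic: "gamma_value holomorphic_on {a. Re a < 7/6}"
proof -
  have "4/3 - a \<notin> \<int>\<^sub>\<le>\<^sub>0" if "Re a < 7/6" for a
    using that by (intro nonpos_Int_Re) simp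
  moreover have "Gamma (2/3 :: complex) \<noteq> 0"
    using nonpos_Int_Re[of "2/3"] by (simp add: Gamma_eq_zero_iff)
  ultimately show ?thesis
    unfolding gamma_value_def by (intro holomorphic_intros) auto
qed

text \<open>
  Powers of real bases have modulus depending on \<open>Re a\<close> only, and the quotient of the two Gamma
  factors is controlled by \<open>norm_rGamma_shift_le\<close> with shift \<open>s = 4/3 - 7/6 = 1/6\<close>.
\<close>
lemma norm_gamma_value_ge:
  obtains \<delta> where "\<delta> > 0" "\<And>a. -1 \<le> Re a \<Longrightarrow> Re a \<le> 0 \<Longrightarrow> \<delta> \<le> norm (gamma_value a)"
proof -
  define g where "g = norm (Gamma (2/3 :: complex))"
  define \<rho> where "\<rho> = rGamma (7/6 :: real) / rGamma (4/3)"
  have g: "g > 0" using nonpos_Int_Re[of "2/3"] by (simp add: g_def Gamma_eq_zero_iff)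
  have rpos: "rGamma (7/6 :: real) > 0" "rGamma (4/3 :: real) > 0"
    using Gamma_real_pos[of "7/6"] Gamma_real_pos[of "4/3"] by (simp_all add: rGamma_inverse_Gamma)
  then have \<rho>: "\<rho> > 0" by (simp add: \<rho>_def)
  show thesis
  proof (rule that)
    show "3 powr (-5) * sqrt pi * \<rho> / g > 0" using g \<rho> by simp
    fix a assume a: "-1 \<le> Re a" "Re a \<le> 0"
    have "norm (rGamma (7/6 - a + of_real (1/6))) * rGamma (7/6) \<le> norm (rGamma (7/6 - a)) * rGamma (7/6 + 1/6)"
      using a by (intro norm_rGamma_shift_le) auto
    then have "norm (rGamma (4/3 - a)) * rGamma (7/6) \<le> norm (rGamma (7/6 - a)) * rGamma (4/3)"
      by (simp add: algebra_simps)
    moreover have "norm (rGamma (4/3 - a)) > 0"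
      using nonpos_Int_Re[of "4/3 - a"] a by (simp add: rGamma_eq_zero_iff)
    moreover have "u / v \<le> inverse n * m" if "n * u \<le> m * v" "0 < n" "0 < v" for u v n m :: real
      using that by (simp add: field_simps)
    ultimately have "\<rho> \<le> inverse (norm (rGamma (4/3 - a))) * norm (rGamma (7/6 - a))"
      unfolding \<rho>_def using rpos(2) by blast
    then have \<rho>le: "\<rho> \<le> norm (Gamma (4/3 - a)) * norm (rGamma (7/6 - a))"
      by (simp add: Gamma_def norm_inverse)
    have p3: "3 powr (-5) \<le> norm ((3::complex) powr (3 * a - 2))"
      using a by (subst norm_powr_real_powr) auto
    have p2: "norm ((2::complex) powr (4 * a - 8/3)) \<le> 1"
    proof -
      have "norm ((2::complex) powr (4 * a - 8/3)) = 2 powr (4 * Re a - 8/3)"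
        by (subst norm_powr_real_powr) auto
      also have "\<dots> \<le> 2 powr 0" using a by (intro powr_mono) auto
      finally show ?thesis by simp
    qed
    have "3 powr (-5) * sqrt pi * \<rho> / g = (3 powr (-5) * sqrt pi * \<rho>) / (1 * g)" by simp
    also have "\<dots> \<le> (norm ((3::complex) powr (3 * a - 2)) * sqrt pi *
        (norm (Gamma (4/3 - a)) * norm (rGamma (7/6 - a)))) / (norm ((2::complex) powr (4 * a - 8/3)) * g)"
      using p3 p2 \<rho>le g \<rho> by (intro frac_le mult_mono mult_right_mono mult_pos_pos) auto
    also have "\<dots> = norm (gamma_value a)"
      by (simp add: gamma_value_def norm_mult norm_divide g_def)
    finally show "3 powr (-5) * sqrt pi * \<rho> / g \<le> norm (gamma_value a)" .
  qed
qed

section \<open>Comparison of the two sides\<close>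

lemma hyp_value_eq_gamma_value_left:
  assumes "Re a < 11/12"
  shows "hyp_value a = gamma_value a"
proof -
  define h where "h a = hyp_value a / gamma_value a" for a
  have hol: "h holomorphic_on {a. Re a < 11/12}"
    unfolding h_def
    by (intro holomorphic_intros hyp_value_holomorphic holomorphic_on_subset[OF gamma_value_holomorphic])
      (auto intro!: gamma_value_nonzero)
  have "h (a + 1) = h a" if a: "Re a + 1 < 11/12" for a
  proof -
    have c: "1/3 - a \<notin> \<int>\<^sub>\<le>\<^sub>0" using a by (intro nonpos_Int_Re) simp
    have "1/3 - a \<noteq> 0" using a by (intro nonzero_Re) simp
    then have "h (a + 1) = ((1/3 - a) * hyp_value (a + 1)) / ((1/3 - a) * gamma_value (a + 1))" by (simp add: h_def)
    also have "\<dots> = (27/16 * (1/6 - a) * hyp_value a) / (27/16 * (1/6 - a) * gamma_value a)"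
      unfolding hyp_value_rec[OF c] gamma_value_rec[OF c] ..
    also have "27/16 * (1/6 - a) \<noteq> 0" using a by (intro nonzero_Re) simp
    then have "(27/16 * (1/6 - a) * hyp_value a) / (27/16 * (1/6 - a) * gamma_value a) = h a"
      unfolding h_def by (rule mult_divide_mult_cancel_left)
    finally show ?thesis .
  qed
  then obtain f where f: "f holomorphic_on UNIV"
      and fh: "\<And>z (k::int). Re z - of_int k < 11/12 \<Longrightarrow> f z = h (z - of_int k)"
    using periodic_half_plane_extension[OF hol] by blast
  obtain \<delta> where \<delta>: "\<delta> > 0" "\<And>a. -1 \<le> Re a \<Longrightarrow> Re a \<le> 0 \<Longrightarrow> \<delta> \<le> norm (gamma_value a)"
    by (rule norm_gamma_value_ge) blast
  define F where "F z = f (z + 1/2) - 1" for z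
  have "F z = 0" for z
  proof (rule entire_vanishing_on_Ints_eq_0[where f = F])
    show "F holomorphic_on UNIV"
    proof -
      have "(\<lambda>z. f (z + 1/2)) holomorphic_on UNIV"
        by (rule holomorphic_on_compose_gen[OF _ f, unfolded o_def]) (auto intro!: holomorphic_intros)
      then show ?thesis unfolding F_def by (intro holomorphic_intros)
    qed
    show "F (of_int n) = 0" for n
      using fh[of "of_int n + 1/2" n] by (simp add: F_def h_def hyp_value_half gamma_value_half)
    \<comment> \<open>The growth rate \<open>2/3\<close> comes from \<open>ln (4/3) \<le> 1/3\<close>, the constant \<open>10/9\<close> from
      \<open>(4/3 + 2) / 3\<close>, where 2 bounds \<open>- 2 Re w\<close>.\<close>
    show "2/3 < pi" using pi_gt3 by simp
    show "norm (F z) \<le> (exp (10/9) / \<delta> + 1) * exp (2/3 * \<bar>Im z\<bar>)" for z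
    proof -
      define k where "k = \<lceil>Re z + 1/2\<rceil>"
      define w where "w = z + 1/2 - of_int k"
      have w: "-1 \<le> Re w" "Re w \<le> 0" "Im w = Im z" unfolding w_def k_def by simp_all linarith+
      have "norm (4/3 - 2 * w) \<le> \<bar>Re (4/3 - 2 * w)\<bar> + \<bar>Im (4/3 - 2 * w)\<bar>" by (rule cmod_le)
      also have "\<dots> \<le> 10/3 + 2 * \<bar>Im z\<bar>" using w by auto
      finally have b: "norm (4/3 - 2 * w) \<le> 10/3 + 2 * \<bar>Im z\<bar>" .
      have "norm (hyp_value w) \<le> (4/3) powr norm (4/3 - 2 * w)" using w by (intro norm_hyp_value_le) simp
      also have "\<dots> \<le> (4/3) powr (10/3 + 2 * \<bar>Im z\<bar>)" using b by (intro powr_mono) auto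
      also have "\<dots> = exp ((10/3 + 2 * \<bar>Im z\<bar>) * ln (4/3))" by (simp add: powr_def)
      also have "\<dots> \<le> exp ((10/3 + 2 * \<bar>Im z\<bar>) * (1/3))"
      proof -
        have "ln (4/3) \<le> (1/3 :: real)" using ln_le_minus_one[of "4/3"] by simp
        then show ?thesis by (intro exp_mono mult_left_mono) auto
      qed
      also have "\<dots> = exp (10/9) * exp (2/3 * \<bar>Im z\<bar>)" by (simp add: algebra_simps flip: exp_add)
      finally have "norm (h w) \<le> exp (10/9) * exp (2/3 * \<bar>Im z\<bar>) / \<delta>"
        unfolding h_def norm_divide using \<delta> w by (intro frac_le) auto
      moreover have "norm (f (z + 1/2)) = norm (h w)"
        using fh[of "z + 1/2" k] w unfolding w_def by simp
      moreover have "1 \<le> exp (2/3 * \<bar>Im z\<bar>)" by simp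
      moreover have "norm (F z) \<le> norm (f (z + 1/2)) + 1"
        unfolding F_def using norm_triangle_ineq4[of "f (z + 1/2)" 1] by simp
      ultimately have "norm (F z) \<le> exp (10/9) * exp (2/3 * \<bar>Im z\<bar>) / \<delta> + exp (2/3 * \<bar>Im z\<bar>)"
        by linarith
      then show ?thesis by (simp add: algebra_simps)
    qed
  qed
  then have "f a = 1" using spec[of "\<lambda>z. F z = 0" "a - 1/2"] by (simp add: F_def)
  moreover have "f a = h a" using fh[of a 0] assms by simp
  ultimately show ?thesis using gamma_value_nonzero[of a] assms by (simp add: h_def field_simps)
qed

text \<open>
  The recurrence leads from \<open>a - 1\<close> to \<open>a\<close> because its leading factor there is \<open>4/3 - a\<close>, which the
  hypothesis keeps away from 0; the hypothesis is inherited by \<open>a - 1\<close>.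
\<close>
lemma hyp_value_eq_gamma_value:
  assumes "4/3 - a \<notin> \<int>\<^sub>\<le>\<^sub>0"
  shows "hyp_value a = gamma_value a"
proof -
  have "hyp_value a = gamma_value a" if "Re a < 11/12 + real n" "4/3 - a \<notin> \<int>\<^sub>\<le>\<^sub>0" for n a
    using that
  proof (induction n arbitrary: a)
    case 0
    then show ?case by (intro hyp_value_eq_gamma_value_left) simp
  next
    case (Suc n)
    have c: "1/3 - (a - 1) \<notin> \<int>\<^sub>\<le>\<^sub>0" using Suc.prems(2) by (simp add: algebra_simps)
    have "4/3 - (a - 1) = (4/3 - a) + 1" by simp
    then have "4/3 - (a - 1) \<notin> \<int>\<^sub>\<le>\<^sub>0"
      using Suc.prems(2) plus_one_in_nonpos_Ints_imp by metis
    then have "hyp_value (a - 1) = gamma_value (a - 1)" using Suc.prems(1) by (intro Suc.IH) simp_all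
    then have "(1/3 - (a - 1)) * hyp_value a = (1/3 - (a - 1)) * gamma_value a"
      using hyp_value_rec[OF c] gamma_value_rec[OF c] by (simp only: diff_add_cancel)
    moreover have "1/3 - (a - 1) \<noteq> 0" using c by force
    ultimately show ?case by (metis mult_cancel_left)
  qed
  moreover obtain n where "Re a < 11/12 + real n"
    using reals_Archimedean2[of "Re a - 11/12"] by (auto simp: algebra_simps)
  ultimately show ?thesis using assms by blast
qed

theorem mainTheorem6:
  fixes a :: complex
  assumes "4/3 - a \<notin> \<int>\<^sub>\<le>\<^sub>0"
  shows "hypergeo_F (1 - 2 * a) (4/3 - 2 * a) (4/3 - a) (- 1/8) =
    (3 powr (3 * a - 2) * complex_of_real (sqrt pi) * Gamma (4/3 - a)) /
    (2 powr (4 * a - 8/3) * Gamma (2/3)) * rGamma (7/6 - a)"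
  using hyp_value_eq_gamma_value[OF assms] unfolding hyp_value_def gamma_value_def .

end
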